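(* There are absolute constants $C,c>0$ such that the following holds. Given a graph $G=(V,E)$ with $|V|=n$, maximum degree $\Delta$ and distinct IDs, and a fixed parameter $1\le p\le\Delta$, there is a distributed algorithm in the LOCAL model running in $O(\log^* n)$ rounds that computes for every vertex $v$ a set $S_v\subseteq\{1,\dots,m\}$ with $m\le C(\Delta/p)^2$ and $|S_v|\ge c\Delta/p$, such that every choice of one color from each $S_v$ is a $p$-defective $m$-coloring of $G$. Thus the solution domain has size $\Omega(\Delta/p)$ and the contingency factor is $O(\Delta/p)$.
   Context: A map $\varphi:V\to\{1,\dots,m\}$ is a $p$-defective $m$-coloring if every vertex has at most $p$ neighbors of its own color. LOCAL model: synchronous rounds, unbounded messages along edges; complexity measured in rounds. Solution domain size $=\min_v|S_v|$; contingency factor $=m/\min_v|S_v|$.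
   Formalization: The distinct IDs are assumed to lie in {0,…,n^k−1} for a fixed k (the algorithm and the O(log* n) constant may depend on k; C, c do not), since with unbounded IDs the claim fails; the closing contingency-factor bound is left as the immediate quotient of the two stated bounds. *)

theory Defs
  imports Complex_Main "HOL-Library.Discrete_Functions"
begin

text \<open>Graphs: vertex set V of natural numbers (the vertices are their own IDs),
  adjacency relation E (symmetric, irreflexive, inside V).\<close>

definition simple_graph :: "nat set \<Rightarrow> (nat \<Rightarrow> nat \<Rightarrow> bool) \<Rightarrow> bool" where
  "simple_graph V E \<longleftrightarrow> finite V \<and> (\<forall>x y. E x y \<longrightarrow> x \<in> V \<and> y \<in> V \<and> x \<noteq> y \<and> E y x)"

definition degree :: "(nat \<Rightarrow> nat \<Rightarrow> bool) \<Rightarrow> nat \<Rightarrow> nat" where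
  "degree E v = card {u. E v u}"

definition max_degree_is :: "nat set \<Rightarrow> (nat \<Rightarrow> nat \<Rightarrow> bool) \<Rightarrow> nat \<Rightarrow> bool" where
  "max_degree_is V E \<Delta> \<longleftrightarrow> (\<forall>v\<in>V. degree E v \<le> \<Delta>) \<and> (\<exists>v\<in>V. degree E v = \<Delta>)"

definition defective_coloring ::
  "nat set \<Rightarrow> (nat \<Rightarrow> nat \<Rightarrow> bool) \<Rightarrow> nat \<Rightarrow> nat \<Rightarrow> (nat \<Rightarrow> nat) \<Rightarrow> bool" where
  "defective_coloring V E p m \<phi> \<longleftrightarrow>
     (\<forall>v\<in>V. \<phi> v \<in> {1..m}) \<and> (\<forall>v\<in>V. card {u. E v u \<and> \<phi> u = \<phi> v} \<le> p)"

definition ball_r :: "(nat \<Rightarrow> nat \<Rightarrow> bool) \<Rightarrow> nat \<Rightarrow> nat \<Rightarrow> nat set" where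
  "ball_r E r v = {u. \<exists>i\<le>r. (E ^^ i) v u}"

text \<open>Output of an r-round LOCAL algorithm A at vertex v: A sees the global
  parameters n, Delta, p and the subgraph induced by the radius-r ball around v
  (with IDs), and nothing else.\<close>
definition run_local ::
  "(nat \<Rightarrow> nat \<Rightarrow> nat \<Rightarrow> nat set \<Rightarrow> (nat \<Rightarrow> nat \<Rightarrow> bool) \<Rightarrow> nat \<Rightarrow> 'b)
   \<Rightarrow> nat \<Rightarrow> nat \<Rightarrow> nat \<Rightarrow> nat \<Rightarrow> (nat \<Rightarrow> nat \<Rightarrow> bool) \<Rightarrow> nat \<Rightarrow> 'b" where
  "run_local A r n \<Delta> p E v =
     A n \<Delta> p (ball_r E r v) (\<lambda>x y. x \<in> ball_r E r v \<and> y \<in> ball_r E r v \<and> E x y) v"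

definition log_star :: "nat \<Rightarrow> nat" where
  "log_star n = (LEAST i. (floor_log ^^ i) n \<le> 1)"

end

theory Submission
  imports Defs "HOL-Computational_Algebra.Primes" "HOL-Computational_Algebra.Polynomial"
begin

text \<open>
  A color below \<open>q ^ (d + 1)\<close>, \<open>q\<close> prime, is read as a polynomial of degree at most \<open>d\<close> over the
  field with \<open>q\<close> elements through its base-\<open>q\<close> digits. Distinct colors agree at no more than \<open>d\<close>
  points, so averaging over the \<open>q\<close> points, a vertex finds a point \<open>a\<close> at which at most \<open>\<Delta> d / q\<close> of
  its differently colored neighbors agree with it; recoloring by the pair \<open>(a, f a)\<close> uses \<open>q\<^sup>2\<close> colors
  and adds at most that much defect. The number of colors drops to its squared logarithm, up to
  factors \<open>\<Delta> / p\<close>. Over \<open>T = O(log* n)\<close> rounds the \<open>i\<close>-th one is allowed to add defect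
  \<open>p 2 ^ i / 2 ^ (T + 1)\<close>; the geometric weights keep the total at \<open>p / 2\<close> while only the last rounds,
  whose weights are constant, influence the final number of colors, which is therefore polynomial in
  \<open>\<Delta> / p\<close>. One more step with constant \<open>d\<close> and \<open>q = \<Theta>(\<Delta> / p)\<close> leaves at least half of the points
  with at most \<open>p / 2\<close> agreeing neighbors. The set \<open>S v\<close> collects the pairs \<open>(a, f a)\<close> for all these
  points: whatever the neighbors choose, a common color \<open>(a, b)\<close> forces agreement at \<open>a\<close>.
\<close>

section \<open>Primes in intervals of bounded ratio\<close>

text \<open>The entries \<open>1 / ((n + 1) * (n choose k))\<close> of the Leibniz harmonic triangle satisfy a difference
  recursion along \<open>k\<close>, so denominators are cleared by \<open>Lcm {1..n + 1}\<close>.\<close>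

lemma Lcm_leibniz_triangle:
  assumes "k \<le> n"
  shows "real (Lcm {1..Suc n}) / (real (Suc n) * real (n choose k)) \<in> \<int>"
  using assms
proof (induction k arbitrary: n)
  case 0
  have "Suc n dvd Lcm {1..Suc n}" by (intro dvd_Lcm) auto
  then obtain c where c: "Lcm {1..Suc n} = Suc n * c" by blast
  have "real (Lcm {1..Suc n}) / (real (Suc n) * real (n choose 0)) = real c"
    unfolding c by (simp add: field_simps)
  then show ?case by simp
next
  case (Suc k)
  then obtain m where n: "n = Suc m" and km: "k \<le> m" by (cases n) auto
  let ?L = "\<lambda>n. Lcm {1..Suc n}"
  have "?L m dvd ?L n" unfolding n by (intro Lcm_least dvd_Lcm) auto
  then obtain c where c: "?L n = ?L m * c" by blast
  have pos: "real (m choose k) > 0" "real (n choose k) > 0" "real (n choose Suc k) > 0"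
    unfolding n of_nat_0_less_iff zero_less_binomial_iff using km by auto
  have s1: "real (Suc k) * real (n choose Suc k) = real n * real (m choose k)"
    using Suc_times_binomial[of k m] unfolding n by (metis of_nat_mult)
  have s3: "real (Suc k) * real (n choose Suc k) = (real n - real k) * real (n choose k)"
  proof -
    have "Suc k * (n choose Suc k) = (n - k) * (n choose k)"
      using Suc.prems binomial_absorption[of k n] binomial_absorb_comp[of n k] n by simp
    then have "real (Suc k) * real (n choose Suc k) = real (n - k) * real (n choose k)"
      by (metis of_nat_mult)
    then show ?thesis using km n by (simp add: of_nat_diff)
  qed
  \<comment> \<open>Each entry of the triangle is the sum of the two below it. Solved for the right
    one of these, both remaining entries lie in column \<open>k\<close>, where the induction
    hypothesis applies.\<close>
  have key: "1 / (real (Suc n) * real (n choose Suc k)) =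
      1 / (real n * real (m choose k)) - 1 / (real (Suc n) * real (n choose k))"
  proof -
    have frac: "1 / ((N + 1) * B) = 1 / ((K + 1) * B) - (N - K) / ((N + 1) * ((K + 1) * B))"
      if "N \<ge> 0" "K \<ge> 0" "B > 0" for N K B :: real
      using that by (simp add: divide_simps)
    have nk: "real n - real k > 0" using km n by simp
    have "1 / (real (Suc n) * real (n choose k)) =
        (real n - real k) / (real (Suc n) * ((real n - real k) * real (n choose k)))"
      using nk by simp
    then have "1 / (real (Suc n) * real (n choose k)) =
        (real n - real k) / ((real n + 1) * ((real k + 1) * real (n choose Suc k)))"
      unfolding s3 [symmetric] by (simp add: add.commute)
    moreover have "real n * real (m choose k) = (real k + 1) * real (n choose Suc k)"
      using s1 by (simp add: add.commute)
    moreover have "real (Suc n) = real n + 1" by simp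
    ultimately show ?thesis using frac[of "real n" "real k" "real (n choose Suc k)"] pos
      by (simp add: add.commute)
  qed
  have c': "real (?L n) = real c * real (?L m)" unfolding c by (simp only: of_nat_mult mult.commute)
  have frac2: "l * (1 / a - 1 / b) = r * (l' / a) - l / b" if "l = r * l'" for l r l' a b :: real
    using that by (simp add: right_diff_distrib)
  have "real (?L n) / (real (Suc n) * real (n choose Suc k)) =
      real (?L n) * (1 / (real n * real (m choose k)) - 1 / (real (Suc n) * real (n choose k)))"
    unfolding key [symmetric] by simp
  also have "\<dots> = real c * (real (?L m) / (real (Suc m) * real (m choose k)))
      - real (?L n) / (real (Suc n) * real (n choose k))"
    unfolding n by (rule frac2, rule c' [unfolded n])
  also have "\<dots> \<in> \<int>"
    using Suc.IH[OF km] Suc.IH[of n] Suc.prems by (intro Ints_diff Ints_mult) auto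
  finally show ?case .
qed

text \<open>A positive integer is at least \<open>1\<close>, so the \<open>Lcm\<close> bounds every
  \<open>Suc n * (n choose k)\<close>; summing over the \<open>n + 1\<close> values of
  \<open>k\<close> turns the binomials into \<open>2 ^ n\<close>.\<close>

lemma Lcm_ge_two_power: "2 ^ n \<le> Lcm {1..Suc n}"
proof -
  let ?L = "Lcm {1..Suc n}"
  have L: "?L > 0" by (rule Nat.gr0I) (simp add: Lcm_0_iff)
  have b: "Suc n * (n choose k) \<le> ?L" if "k \<le> n" for k
  proof -
    let ?r = "real ?L / (real (Suc n) * real (n choose k))"
    have pos: "real (Suc n) * real (n choose k) > 0" using that by (simp add: zero_less_binomial_iff)
    have "?r > 0" using L pos by (simp del: of_nat_Suc)
    moreover have "?r \<in> \<int>" using Lcm_leibniz_triangle[OF that] .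
    ultimately have "?r \<ge> 1" by (auto elim!: Ints_cases)
    then have "real (Suc n) * real (n choose k) \<le> real ?L" using pos by (simp add: le_divide_eq)
    then show ?thesis by (metis of_nat_le_iff of_nat_mult)
  qed
  have "Suc n * 2 ^ n = (\<Sum>k\<le>n. Suc n * (n choose k))"
    by (simp only: choose_row_sum flip: sum_distrib_left)
  also have "\<dots> \<le> (\<Sum>k\<le>n. ?L)" by (intro sum_mono b) auto
  also have "\<dots> = Suc n * ?L" by simp
  finally show ?thesis by (simp only: Suc_mult_le_cancel1)
qed

section \<open>Upper bounds for products of primes\<close>

lemma prod_primes_dvd:
  fixes N :: nat
  assumes "finite A" "\<And>p. p \<in> A \<Longrightarrow> prime p \<and> p dvd N"
  shows "\<Prod>A dvd N"
  using assms
proof (induction A rule: finite_induct)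
  case (insert p A)
  have "coprime p (\<Prod>A)"
    using insert by (intro prod_coprime_right) (metis insertI1 insertI2 primes_coprime)
  then show ?case using insert by (simp add: divides_mult)
qed simp

text \<open>Erdos's argument. An even \<open>n > 2\<close> is not prime. For
  \<open>n = 2 * m + 1\<close> the primes above \<open>m + 1\<close> divide
  \<open>n choose m\<close>, as they divide \<open>fact n\<close> but neither \<open>fact m\<close>
  nor \<open>fact (n - m)\<close>; the others are covered by induction.\<close>

lemma primorial_le: "\<Prod>{p::nat. prime p \<and> p \<le> n} \<le> 4 ^ n"
proof (induction n rule: less_induct)
  case (less n)
  consider "n < 2" | "n = 2" | "n > 2" "even n" | m where "n = 2 * m + 1" "m \<ge> 1"
  proof (cases "n > 2 \<and> odd n")
    case True
    then obtain m where "n = 2 * m + 1" by (auto elim: oddE)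
    then show ?thesis using True that(4)[of m] by auto
  next
    case False
    then show ?thesis using that(1-3) by (metis linorder_neqE_nat)
  qed
  then show ?case
  proof cases
    case 1
    then have "{p::nat. prime p \<and> p \<le> n} = {}" by (auto dest!: prime_ge_2_nat)
    then show ?thesis by (metis one_le_power prod.empty one_le_numeral)
  next
    case 2
    have "{p::nat. prime p \<and> p \<le> n} = {2}" using 2 by (auto dest: prime_ge_2_nat)
    then show ?thesis using 2 by simp
  next
    case 3
    have "{p::nat. prime p \<and> p \<le> n} = {p. prime p \<and> p \<le> n - 1}"
    proof -
      have "p \<noteq> n" if "prime p" for p using that 3 primes_dvd_imp_eq[OF two_is_prime_nat, of p] by auto
      then show ?thesis using 3 by (auto simp: le_less)
    qed
    then have "\<Prod>{p::nat. prime p \<and> p \<le> n} \<le> 4 ^ (n - 1)" using less.IH[of "n - 1"] 3 by simp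
    also have "\<dots> \<le> 4 ^ n" by (intro power_increasing) auto
    finally show ?thesis .
  next
    case (4 m)
    let ?B = "{p::nat. prime p \<and> m + 1 < p \<and> p \<le> n}"
    have split: "{p::nat. prime p \<and> p \<le> n} = {p. prime p \<and> p \<le> m + 1} \<union> ?B" using 4 by auto
    have "p dvd (n choose m)" if "p \<in> ?B" for p
    proof -
      have "p dvd fact n" using that by (simp add: prime_dvd_fact_iff)
      then have "p dvd fact m * fact (n - m) * (n choose m)"
        using 4 binomial_fact_lemma[of m n] by simp
      moreover have "\<not> p dvd fact j" if "j < p" for j
        using that \<open>p \<in> ?B\<close> by (simp add: prime_dvd_fact_iff)
      from this[of m] this[of "n - m"] have "\<not> p dvd fact m" "\<not> p dvd fact (n - m)"
        using that 4 by simp_all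
      ultimately show ?thesis using that by (simp only: prime_dvd_mult_iff mem_Collect_eq simp_thms)
    qed
    then have "\<Prod>?B dvd (n choose m)" by (intro prod_primes_dvd) auto
    then have "\<Prod>?B \<le> (n choose m)" using 4 by (intro dvd_imp_le) auto
    \<comment> \<open>The two middle binomials of row \<open>2 * m + 1\<close> are equal and
      together at most \<open>2 ^ n = 2 * 4 ^ m\<close>.\<close>
    also have "\<dots> \<le> 4 ^ m"
    proof -
      have "(n choose m) + (n choose Suc m) = (\<Sum>k\<in>{m, Suc m}. n choose k)" by simp
      also have "\<dots> \<le> (\<Sum>k\<le>n. n choose k)" using 4 by (intro sum_mono2) auto
      also have "\<dots> = 2 * 4 ^ m" unfolding choose_row_sum using 4 by (simp add: power_mult)
      finally have "(n choose m) + (n choose Suc m) \<le> 2 * 4 ^ m" .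
      moreover have "n choose Suc m = n choose m" using 4 binomial_symmetric[of m n] by simp
      ultimately show ?thesis by simp
    qed
    finally have B: "\<Prod>?B \<le> 4 ^ m" .
    have "\<Prod>{p::nat. prime p \<and> p \<le> n} = \<Prod>{p::nat. prime p \<and> p \<le> m + 1} * \<Prod>?B"
      unfolding split by (intro prod.union_disjoint) auto
    also have "\<dots> \<le> 4 ^ (m + 1) * 4 ^ m"
      using less.IH[of "m + 1"] 4 B by (intro mult_mono) auto
    finally show ?thesis using 4 by (simp add: power_add [symmetric] mult_2 del: power_Suc)
  qed
qed

text \<open>Each prime enters the \<open>Lcm\<close> with its largest power up to
  \<open>s ^ 2\<close>. There are at most \<open>s\<close> primes up to \<open>s\<close>, each
  contributing at most \<open>s ^ 2\<close>; larger ones contribute their first power only, together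
  at most the primorial of \<open>y\<close>.\<close>

lemma Lcm_le_of_no_primes:
  fixes s y :: nat
  assumes no: "\<And>p. prime p \<Longrightarrow> p \<le> s ^ 2 \<Longrightarrow> p \<le> y" and s: "s > 0"
  shows "Lcm {1..s ^ 2} \<le> (s ^ 2) ^ s * 4 ^ y"
proof -
  let ?N = "s ^ 2"
  define P where "P = {p::nat. prime p \<and> p \<le> y}"
  define e where "e p = (GREATEST e. p ^ e \<le> ?N)" for p :: nat
  have fin: "finite P" unfolding P_def by auto
  have e: "p ^ e p \<le> ?N \<and> (\<forall>j. p ^ j \<le> ?N \<longrightarrow> j \<le> e p)" if "prime p" for p
  proof -
    have bd: "\<And>j. p ^ j \<le> ?N \<Longrightarrow> j \<le> ?N"
      using that by (meson less_exp le_trans nat_less_le power_mono prime_ge_2_nat zero_le)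
    have "p ^ 0 \<le> ?N" using s by simp
    then show ?thesis unfolding e_def using bd
      by (metis (mono_tags, lifting) GreatestI_nat Greatest_le_nat)
  qed
  define Z where "Z = (\<Prod>p\<in>P. p ^ e p)"
  have Z: "Z > 0" unfolding Z_def P_def by (intro prod_pos) (auto intro: prime_gt_0_nat)
  have "m dvd Z" if m: "m \<in> {1..?N}" for m
  proof (rule multiplicity_le_imp_dvd)
    fix p :: nat assume p: "prime p"
    show "multiplicity p m \<le> multiplicity p Z"
    proof (cases "p dvd m")
      case True
      have "p \<le> m" using True m by (intro dvd_imp_le) auto
      then have pP: "p \<in> P" using p no m unfolding P_def by auto
      have "p ^ multiplicity p m \<le> m" using m by (intro dvd_imp_le multiplicity_dvd) auto
      then have "multiplicity p m \<le> e p" using e[OF p] m by auto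
      also have "p ^ e p dvd Z" unfolding Z_def using pP fin by (intro dvd_prodI)
      then have "e p \<le> multiplicity p Z" using Z p by (intro multiplicity_geI) auto
      finally show ?thesis .
    qed (simp add: not_dvd_imp_multiplicity_0)
  qed (use m in auto)
  then have "Lcm {1..?N} dvd Z" by (intro Lcm_least)
  then have "Lcm {1..?N} \<le> Z" using Z by (intro dvd_imp_le)
  also have "Z = (\<Prod>p\<in>P \<inter> {..s}. p ^ e p) * (\<Prod>p\<in>P - {..s}. p ^ e p)"
    unfolding Z_def using fin by (subst prod.Int_Diff[of _ _ "{..s}"]) auto
  also have "\<dots> \<le> ?N ^ s * 4 ^ y"
  proof (intro mult_mono)
    have "(\<Prod>p\<in>P \<inter> {..s}. p ^ e p) \<le> (\<Prod>p\<in>P \<inter> {..s}. ?N)"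
      by (intro prod_mono) (auto simp: P_def e)
    also have "\<dots> = ?N ^ card (P \<inter> {..s})" by simp
    also have "\<dots> \<le> ?N ^ s"
    proof (intro power_increasing)
      have "P \<inter> {..s} \<subseteq> {1..s}" unfolding P_def using prime_ge_1_nat by auto
      then show "card (P \<inter> {..s}) \<le> s" by (metis card_atLeastAtMost card_mono diff_Suc_1 finite_atLeastAtMost)
      show "1 \<le> ?N" using s by simp
    qed
    finally show "(\<Prod>p\<in>P \<inter> {..s}. p ^ e p) \<le> ?N ^ s" .
    have "(\<Prod>p\<in>P - {..s}. p ^ e p) \<le> (\<Prod>p\<in>P - {..s}. p)"
    proof (intro prod_mono conjI)
      fix p assume p: "p \<in> P - {..s}"
      have "e p \<le> 1"
      proof (rule ccontr)
        assume "\<not> e p \<le> 1"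
        then have "p ^ 2 \<le> p ^ e p" using p by (intro power_increasing) auto
        also have "\<dots> \<le> s ^ 2" using e p unfolding P_def by auto
        finally show False using p by (simp add: power2_nat_le_eq_le)
      qed
      then show "p ^ e p \<le> p" using p power_increasing[of "e p" 1 p] by auto
    qed auto
    also have "\<dots> \<le> \<Prod>P" using fin unfolding P_def
      by (intro dvd_imp_le prod_dvd_prod_subset prod_pos) (auto intro: prime_gt_0_nat)
    also have "\<dots> \<le> 4 ^ y" unfolding P_def by (rule primorial_le)
    finally show "(\<Prod>p\<in>P - {..s}. p ^ e p) \<le> 4 ^ y" .
  qed auto
  finally show ?thesis .
qed

text \<open>Otherwise the bounds on \<open>Lcm {1..4 ^ Suc j}\<close> collide: as powers of two, the
  lower one has exponent \<open>4 * 4 ^ j - 1\<close>, the upper one \<open>2 * 4 ^ j\<close> plus a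
  term of order \<open>j * 2 ^ j\<close>. Powers of four have the integral square root that the
  upper bound asks for.\<close>

lemma prime_between_powers_of_four:
  assumes "j \<ge> 4"
  shows "\<exists>p::nat. prime p \<and> 4 ^ j < p \<and> p \<le> 4 ^ Suc j"
proof (rule ccontr)
  assume neg: "\<not> ?thesis"
  have sq: "((2::nat) ^ Suc j) ^ 2 = 4 * 4 ^ j"
    by (simp add: power2_eq_square flip: power_mult_distrib)
  have no: "\<And>p::nat. prime p \<Longrightarrow> p \<le> (2 ^ Suc j) ^ 2 \<Longrightarrow> p \<le> 4 ^ j"
    unfolding sq using neg by (metis linorder_not_le power_Suc)
  have "(2::nat) ^ (4 * 4 ^ j - 1) \<le> Lcm {1..Suc (4 * 4 ^ j - 1)}" by (rule Lcm_ge_two_power)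
  also have "Suc (4 * 4 ^ j - 1) = ((2::nat) ^ Suc j) ^ 2" using sq by simp
  also have "Lcm {1..((2::nat) ^ Suc j) ^ 2} \<le> ((2 ^ Suc j) ^ 2) ^ (2 ^ Suc j) * 4 ^ 4 ^ j"
    using no by (intro Lcm_le_of_no_primes) auto
  also have "\<dots> = 2 ^ (4 * Suc j * 2 ^ j + 2 * 4 ^ j)"
  proof -
    have "((2::nat) ^ Suc j) ^ 2 = 2 ^ (2 * Suc j)" by (simp only: power_mult [symmetric] mult.commute)
    moreover have "(4::nat) ^ 4 ^ j = 2 ^ (2 * 4 ^ j)" by (simp add: power_mult)
    moreover have "2 * Suc j * 2 ^ Suc j = 4 * Suc j * 2 ^ j" by (simp add: algebra_simps)
    ultimately show ?thesis by (simp only: power_add power_mult [symmetric])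
  qed
  finally have "4 * (4::nat) ^ j - 1 \<le> 4 * Suc j * 2 ^ j + 2 * 4 ^ j"
    by (rule power_le_imp_le_exp [rotated]) simp
  then have "2 * (4::nat) ^ j \<le> 4 * Suc j * 2 ^ j + 1" by simp
  moreover have "(4::nat) ^ j = 2 ^ j * 2 ^ j" by (simp flip: power_mult_distrib)
  \<comment> \<open>Here \<open>j \<ge> 4\<close> enters: the inequality fails at
    \<open>j = 3\<close>.\<close>
  moreover have "2 * Suc j + 1 \<le> 2 ^ j" using assms
  proof (induction j rule: dec_induct)
    case (step n) then show ?case by simp
  qed simp
  then have "(2 * Suc j + 1) * 2 ^ j \<le> 2 ^ j * (2::nat) ^ j" by (intro mult_right_mono) auto
  ultimately show False
    using one_less_power[of "2::nat" j] assms by (simp add: algebra_simps)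
qed

lemma prime_in_linear_range:
  assumes "y \<ge> 1"
  shows "\<exists>q::nat. prime q \<and> y \<le> q \<and> q \<le> 2 ^ 10 * y"
proof -
  define j where "j = (LEAST j. y \<le> 4 ^ j)"
  have "y \<le> 2 ^ y" by (simp add: less_imp_le_nat)
  also have "\<dots> \<le> 4 ^ y" by (intro power_mono) auto
  finally have "\<exists>j. y \<le> 4 ^ j" ..
  then have j: "y \<le> 4 ^ j" unfolding j_def by (rule LeastI_ex)
  have j4: "4 ^ j \<le> 4 * y"
  proof (cases j)
    case (Suc i)
    then have "\<not> y \<le> 4 ^ i" unfolding j_def using not_less_Least[of i "\<lambda>j. y \<le> 4 ^ j"] by simp
    then show ?thesis using Suc by simp
  qed (use assms in auto)
  obtain q :: nat where q: "prime q" "4 ^ max j 4 < q" "q \<le> 4 ^ Suc (max j 4)"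
    using prime_between_powers_of_four[of "max j 4"] by auto
  have "(4::nat) ^ j \<le> 4 ^ max j 4" by (intro power_increasing) auto
  \<comment> \<open>\<open>2 ^ 10 = 4 ^ 5\<close> is dictated by small \<open>y\<close>, where
    \<open>j\<close> is raised to \<open>4\<close>; for \<open>j > 4\<close> the factor
    \<open>16\<close> is enough.\<close>
  moreover have "(4::nat) ^ Suc (max j 4) \<le> 2 ^ 10 * y"
  proof (cases "j \<le> 4")
    case True then show ?thesis using assms by (simp add: max_def)
  next
    case False then show ?thesis using j4 by (simp add: max_def)
  qed
  ultimately show ?thesis using q j by (meson le_trans less_imp_le_nat)
qed

section \<open>Polynomials modulo a prime\<close>

text \<open>Lagrange's theorem over the field with \<open>q\<close> elements, expressed by
  divisibility in \<open>int\<close>. Synthetic division at a root leaves a remainder divisible by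
  \<open>q\<close>; hence the quotient stays nonzero modulo \<open>q\<close>, and since
  \<open>q\<close> is prime it inherits every other root.\<close>

lemma card_roots_mod_prime_le:
  fixes P :: "int poly" and q :: nat
  assumes q: "prime q" and "\<exists>i. \<not> int q dvd coeff P i" and "Polynomial.degree P \<le> d"
  shows "card {a \<in> {..<q}. int q dvd poly P (int a)} \<le> d"
  using assms(2,3)
proof (induction d arbitrary: P)
  case 0
  then obtain c where c: "P = [:c:]" by (auto elim: degree_eq_zeroE)
  have "\<not> int q dvd c"
  proof
    assume "int q dvd c"
    then have "int q dvd coeff P i" for i unfolding c by (cases i) auto
    with 0 show False by blast
  qed
  then show ?case unfolding c by simp
next
  case (Suc d)
  show ?case
  proof (cases "\<exists>a<q. int q dvd poly P (int a)")
    case False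
    then have "{a \<in> {..<q}. int q dvd poly P (int a)} = {}" by auto
    then show ?thesis by (metis card.empty zero_le)
  next
    case True
    then obtain c where c: "c < q" "int q dvd poly P (int c)" by blast
    define Q where "Q = synthetic_div P (int c)"
    have P: "P = [:- int c, 1:] * Q + [:poly P (int c):]"
      unfolding Q_def by (rule synthetic_div_correct' [symmetric])
    have "\<exists>i. \<not> int q dvd coeff Q i"
    proof (rule ccontr)
      assume "\<not> ?thesis"
      then have "int q dvd coeff ([:- int c, 1:] * Q + [:poly P (int c):]) i" for i
        using c by (auto simp: coeff_pCons split: nat.splits)
      then show False using P Suc.prems(1) by metis
    qed
    moreover have "Polynomial.degree Q \<le> d" unfolding Q_def degree_synthetic_div using Suc.prems by simp
    ultimately have Q: "card {a \<in> {..<q}. int q dvd poly Q (int a)} \<le> d" by (rule Suc.IH)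
    have "{a \<in> {..<q}. int q dvd poly P (int a)} \<subseteq> insert c {a \<in> {..<q}. int q dvd poly Q (int a)}"
    proof
      fix a assume "a \<in> {a \<in> {..<q}. int q dvd poly P (int a)}"
      then have a: "a < q" "int q dvd poly P (int a)" by auto
      have "poly P (int a) = (int a - int c) * poly Q (int a) + poly P (int c)"
        by (subst P) (simp add: algebra_simps)
      then have "int q dvd (int a - int c) * poly Q (int a)"
        using a c by (metis dvd_add_left_iff)
      then have "int q dvd int a - int c \<or> int q dvd poly Q (int a)"
        using q by (simp add: prime_dvd_mult_iff)
      moreover have "a = c" if "int q dvd int a - int c"
      proof (rule ccontr)
        assume "a \<noteq> c"
        then have "int q \<le> \<bar>int a - int c\<bar>" using that by (intro zdvd_imp_le) auto
        then show False using a c by linarith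
      qed
      ultimately show "a \<in> insert c {a \<in> {..<q}. int q dvd poly Q (int a)}" using a by auto
    qed
    then have "card {a \<in> {..<q}. int q dvd poly P (int a)}
        \<le> card (insert c {a \<in> {..<q}. int q dvd poly Q (int a)})" by (intro card_mono) auto
    also have "\<dots> \<le> Suc d" using Q by (simp add: card_insert_if)
    finally show ?thesis .
  qed
qed

lemma digits_inject:
  fixes q :: nat
  assumes "x < q ^ d" "y < q ^ d" "\<And>i. i < d \<Longrightarrow> x div q ^ i mod q = y div q ^ i mod q"
  shows "x = y"
  using assms
proof (induction d arbitrary: x y)
  case (Suc d)
  have "x div q < q ^ d" "y div q < q ^ d"
    using Suc.prems by (auto simp: less_mult_imp_div_less mult.commute)
  moreover have "x div q div q ^ i mod q = y div q div q ^ i mod q" if "i < d" for i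
    using Suc.prems(3)[of "Suc i"] that by (simp add: div_mult2_eq)
  ultimately have "x div q = y div q" by (rule Suc.IH)
  moreover have "x mod q = y mod q" using Suc.prems(3)[of 0] by simp
  ultimately show ?case by (metis div_mult_mod_eq)
qed simp

definition digit_poly :: "nat \<Rightarrow> nat \<Rightarrow> nat \<Rightarrow> nat \<Rightarrow> nat" where
  "digit_poly q d c a = (\<Sum>i\<le>d. (c div q ^ i mod q) * a ^ i) mod q"

lemma digit_poly_less: "q > 0 \<Longrightarrow> digit_poly q d c a < q"
  by (simp add: digit_poly_def)

text \<open>Distinct colors differ in one of the \<open>Suc d\<close> digits. Digits are below
  \<open>q\<close>, so the difference polynomial is nonzero modulo \<open>q\<close>, and its roots
  are the points of agreement.\<close>

lemma digit_poly_agree_le: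
  assumes q: "prime q" and "c < q ^ Suc d" "c' < q ^ Suc d" "c \<noteq> c'"
  shows "card {a \<in> {..<q}. digit_poly q d c a = digit_poly q d c' a} \<le> d"
proof -
  define D where "D i = int (c div q ^ i mod q) - int (c' div q ^ i mod q)" for i
  define P where "P = (\<Sum>i\<le>d. monom (D i) i)"
  have q0: "q > 0" using q by (simp add: prime_gt_0_nat)
  have coeff: "coeff P i = (if i \<le> d then D i else 0)" for i
    unfolding P_def by (simp add: coeff_sum)
  obtain i where i: "i < Suc d" "c div q ^ i mod q \<noteq> c' div q ^ i mod q"
    using digits_inject[of c q "Suc d" c'] assms by blast
  have "\<not> int q dvd D i"
  proof
    assume dv: "int q dvd D i"
    have "D i \<noteq> 0" using i by (simp add: D_def)
    then have "int q \<le> \<bar>D i\<bar>" using dv by (intro zdvd_imp_le) auto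
    moreover have "c div q ^ i mod q < q" "c' div q ^ i mod q < q" using q0 by auto
    ultimately show False unfolding D_def by linarith
  qed
  then have "\<exists>i. \<not> int q dvd coeff P i" using i coeff by (metis less_Suc_eq_le)
  moreover have "Polynomial.degree P \<le> d" by (rule degree_le) (simp add: coeff)
  ultimately have "card {a \<in> {..<q}. int q dvd poly P (int a)} \<le> d"
    by (rule card_roots_mod_prime_le[OF q])
  moreover have "digit_poly q d c a = digit_poly q d c' a \<longleftrightarrow> int q dvd poly P (int a)" for a
  proof -
    have "poly P (int a) = int (\<Sum>i\<le>d. (c div q ^ i mod q) * a ^ i) - int (\<Sum>i\<le>d. (c' div q ^ i mod q) * a ^ i)"
      unfolding P_def D_def by (simp add: poly_sum poly_monom left_diff_distrib sum_subtractf)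
    moreover have "x mod q = y mod q \<longleftrightarrow> int q dvd int x - int y" for x y
      by (simp add: mod_eq_dvd_iff [symmetric] flip: of_nat_mod)
    ultimately show ?thesis unfolding digit_poly_def by (simp only:)
  qed
  ultimately show ?thesis by simp
qed

section \<open>Recoloring with bounded additional defect\<close>

text \<open>Neighbors with the color of \<open>v\<close> agree with it at every point; they are left
  out because the old defect already counts them.\<close>

definition conflicts ::
  "(nat \<Rightarrow> nat \<Rightarrow> bool) \<Rightarrow> (nat \<Rightarrow> nat) \<Rightarrow> nat \<Rightarrow> nat \<Rightarrow> nat \<Rightarrow> nat \<Rightarrow> nat" where
  "conflicts E f q d v a =
     card {u. E v u \<and> f u \<noteq> f v \<and> digit_poly q d (f u) a = digit_poly q d (f v) a}"

text \<open>The tolerance of \<open>D / t\<close> conflicts is multiplied out to stay in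
  \<open>nat\<close>.\<close>

definition free_points ::
  "(nat \<Rightarrow> nat \<Rightarrow> bool) \<Rightarrow> (nat \<Rightarrow> nat) \<Rightarrow> nat \<Rightarrow> nat \<Rightarrow> nat \<Rightarrow> nat \<Rightarrow> nat \<Rightarrow> nat set" where
  "free_points E f q d t D v = {a. a < q \<and> t * conflicts E f q d v a \<le> D}"

text \<open>Double counting: after exchanging the sums, each differently colored neighbor
  contributes at most \<open>d\<close> points.\<close>

lemma sum_conflicts_le:
  assumes q: "prime q" and fin: "finite {u. E v u}"
    and "f v < q ^ Suc d" "\<And>u. E v u \<Longrightarrow> f u < q ^ Suc d"
  shows "(\<Sum>a<q. conflicts E f q d v a) \<le> card {u. E v u} * d"
proof -
  let ?P = "\<lambda>u a. f u \<noteq> f v \<and> digit_poly q d (f u) a = digit_poly q d (f v) a"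
  have "conflicts E f q d v a = (\<Sum>u\<in>{u. E v u}. if ?P u a then 1 else 0)" for a
    unfolding conflicts_def using fin by (simp add: sum.If_cases Int_def)
  then have "(\<Sum>a<q. conflicts E f q d v a) = (\<Sum>u\<in>{u. E v u}. \<Sum>a<q. if ?P u a then 1 else 0)"
    by (simp add: sum.swap[of _ _ "{..<q}"])
  also have "\<dots> \<le> (\<Sum>u\<in>{u. E v u}. d)"
  proof (intro sum_mono)
    fix u assume u: "u \<in> {u. E v u}"
    have "(\<Sum>a<q. if ?P u a then 1 else 0) = card {a \<in> {..<q}. ?P u a}"
      by (simp add: sum.If_cases Int_def)
    also have "\<dots> \<le> d"
    proof (cases "f u = f v")
      case False
      then show ?thesis using digit_poly_agree_le[OF q, of "f u" d "f v"] assms u by simp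
    qed simp
    finally show "(\<Sum>a<q. if ?P u a then 1 else 0) \<le> d" .
  qed
  finally show ?thesis by simp
qed

text \<open>Markov's inequality: a non-free point below \<open>q\<close> has
  \<open>t * conflicts\<close> at least \<open>Suc D\<close>.\<close>

lemma few_non_free_points:
  assumes "prime q" "finite {u. E v u}"
    and "f v < q ^ Suc d" "\<And>u. E v u \<Longrightarrow> f u < q ^ Suc d"
  shows "(q - card (free_points E f q d t D v)) * Suc D \<le> t * (card {u. E v u} * d)"
proof -
  let ?F = "free_points E f q d t D v"
  have F: "?F \<subseteq> {..<q}" unfolding free_points_def by auto
  then have "(q - card ?F) * Suc D = (\<Sum>a\<in>{..<q} - ?F. Suc D)"
    by (subst sum_constant, subst card_Diff_subset) (auto intro: finite_subset)
  also have "\<dots> \<le> (\<Sum>a\<in>{..<q} - ?F. t * conflicts E f q d v a)"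
    by (intro sum_mono) (auto simp: free_points_def)
  also have "\<dots> \<le> (\<Sum>a<q. t * conflicts E f q d v a)" by (intro sum_mono2) auto
  also have "\<dots> = t * (\<Sum>a<q. conflicts E f q d v a)" by (simp add: sum_distrib_left)
  also have "\<dots> \<le> t * (card {u. E v u} * d)" using sum_conflicts_le[of q E v f d] assms by simp
  finally show ?thesis .
qed

text \<open>Division by \<open>q\<close> recovers the point from a new color, so a neighbor with the
  same new color used the same \<open>a\<close> and agrees there. The neighbors' points are
  otherwise arbitrary, so the bound serves both \<open>recolor\<close> and
  \<open>color_set\<close>.\<close>

lemma card_same_color_le:
  assumes q: "q > 0" and fin: "finite {u. E v u}"
    and v: "g v = a * q + digit_poly q d (f v) a"
    and u: "\<And>u. E v u \<Longrightarrow> \<exists>b. g u = b * q + digit_poly q d (f u) b"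
  shows "card {u. E v u \<and> g u = g v} \<le> card {u. E v u \<and> f u = f v} + conflicts E f q d v a"
proof -
  have "digit_poly q d (f w) a = digit_poly q d (f v) a" if w: "E v w" "g w = g v" for w
  proof -
    obtain b where b: "g w = b * q + digit_poly q d (f w) b" using u[OF w(1)] by blast
    have r: "digit_poly q d (f w) b < q" "digit_poly q d (f v) a < q" using digit_poly_less[OF q] by auto
    have "b = g w div q" using b r by simp
    also have "\<dots> = a" using v r w(2) by simp
    finally show ?thesis using b v w(2) by simp
  qed
  then have "{u. E v u \<and> g u = g v} \<subseteq> {u. E v u \<and> f u = f v} \<union>
      {u. E v u \<and> f u \<noteq> f v \<and> digit_poly q d (f u) a = digit_poly q d (f v) a}" by auto
  then have "card {u. E v u \<and> g u = g v} \<le> card ({u. E v u \<and> f u = f v} \<union>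
      {u. E v u \<and> f u \<noteq> f v \<and> digit_poly q d (f u) a = digit_poly q d (f v) a})"
    using fin by (intro card_mono) auto
  also have "\<dots> \<le> card {u. E v u \<and> f u = f v} + conflicts E f q d v a"
    unfolding conflicts_def by (rule card_Un_le)
  finally show ?thesis .
qed

definition recolor ::
  "(nat \<Rightarrow> nat \<Rightarrow> bool) \<Rightarrow> (nat \<Rightarrow> nat) \<Rightarrow> nat \<Rightarrow> nat \<Rightarrow> nat \<Rightarrow> nat \<Rightarrow> nat \<Rightarrow> nat" where
  "recolor E f q d t D v =
     (let a = (LEAST a. a \<in> free_points E f q d t D v) in a * q + digit_poly q d (f v) a)"

text \<open>\<open>Suc\<close> shifts the codes \<open>0, ..., q ^ 2 - 1\<close> to a palette
  starting at \<open>1\<close>.\<close>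

definition color_set ::
  "(nat \<Rightarrow> nat \<Rightarrow> bool) \<Rightarrow> (nat \<Rightarrow> nat) \<Rightarrow> nat \<Rightarrow> nat \<Rightarrow> nat \<Rightarrow> nat \<Rightarrow> nat \<Rightarrow> nat set" where
  "color_set E f q d t D v =
     (\<lambda>a. Suc (a * q + digit_poly q d (f v) a)) ` free_points E f q d t D v"

lemma encode_less:
  fixes a q r :: nat
  assumes "a < q" "r < q"
  shows "a * q + r < q ^ 2"
proof -
  have "a * q + r < Suc a * q" using assms by simp
  also have "\<dots> \<le> q * q" using assms by (intro mult_right_mono) auto
  finally show ?thesis by (simp add: power2_eq_square)
qed

text \<open>Here \<open>D\<close> bounds the degree as well. Without a free point, Markov would give
  \<open>q * Suc D \<le> t * d * D \<le> q * D\<close>.\<close>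

lemma recolor_obtain:
  assumes q: "prime q" and N: "finite {u. E v u}" "card {u. E v u} \<le> D"
    and f: "f v < q ^ Suc d" "\<And>u. E v u \<Longrightarrow> f u < q ^ Suc d" and td: "t * d \<le> q"
  obtains a where "a < q" "t * conflicts E f q d v a \<le> D"
    "recolor E f q d t D v = a * q + digit_poly q d (f v) a"
proof -
  let ?F = "free_points E f q d t D v"
  have "?F \<noteq> {}"
  proof
    assume "?F = {}"
    then have "q * Suc D \<le> t * (card {u. E v u} * d)"
      using few_non_free_points[of q E v f d t D] q N(1) f by simp
    also have "\<dots> \<le> t * (D * d)" using N by (intro mult_left_mono mult_right_mono) auto
    also have "\<dots> = t * d * D" by simp
    also have "\<dots> \<le> q * D" using td by (rule mult_right_mono) simp
    finally show False using prime_gt_0_nat[OF q] by simp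
  qed
  then have "(LEAST a. a \<in> ?F) \<in> ?F" by (metis LeastI ex_in_conv)
  then show ?thesis using that unfolding recolor_def free_points_def Let_def by auto
qed

text \<open>Locality of one round: only the edges at \<open>v\<close> and the colors of
  \<open>v\<close> and its neighbors are read.\<close>

lemma free_points_cong:
  assumes "\<And>u. E v u \<longleftrightarrow> E' v u" "f v = f' v" "\<And>u. E v u \<Longrightarrow> f u = f' u"
  shows "free_points E f q d t D v = free_points E' f' q d t D v"
proof -
  have "{u. E v u \<and> f u \<noteq> f v \<and> digit_poly q d (f u) a = digit_poly q d (f v) a} =
      {u. E' v u \<and> f' u \<noteq> f' v \<and> digit_poly q d (f' u) a = digit_poly q d (f' v) a}" for a
    using assms by auto
  then show ?thesis unfolding free_points_def conflicts_def by simp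
qed

lemma recolor_cong:
  assumes "\<And>u. E v u \<longleftrightarrow> E' v u" "f v = f' v" "\<And>u. E v u \<Longrightarrow> f u = f' u"
  shows "recolor E f q d t D v = recolor E' f' q d t D v"
  using free_points_cong[of E v E' f f' q d t D] assms by (simp add: recolor_def)

lemma color_set_cong:
  assumes "\<And>u. E v u \<longleftrightarrow> E' v u" "f v = f' v" "\<And>u. E v u \<Longrightarrow> f u = f' u"
  shows "color_set E f q d t D v = color_set E' f' q d t D v"
  using free_points_cong[of E v E' f f' q d t D] assms by (simp add: color_set_def)

section \<open>Iteration and locality\<close>

fun iter_color ::
  "(nat \<Rightarrow> nat) \<Rightarrow> (nat \<Rightarrow> nat) \<Rightarrow> (nat \<Rightarrow> nat) \<Rightarrow> nat \<Rightarrow> (nat \<Rightarrow> nat \<Rightarrow> bool) \<Rightarrow> nat \<Rightarrow> nat \<Rightarrow> nat" where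
  "iter_color qs ds ts D E 0 v = v"
| "iter_color qs ds ts D E (Suc i) v =
     recolor E (iter_color qs ds ts D E i) (qs i) (ds i) (ts i) D v"

lemma ball_r_neighbor:
  assumes "u \<in> ball_r E j v" "E u w"
  shows "w \<in> ball_r E (Suc j) v"
proof -
  obtain i where "i \<le> j" "(E ^^ i) v u" using assms unfolding ball_r_def by auto
  then have "(E ^^ Suc i) v w" using assms(2) by auto
  then show ?thesis unfolding ball_r_def using \<open>i \<le> j\<close> by (auto simp del: relpowp.simps)
qed

lemma ball_r_mono: "i \<le> j \<Longrightarrow> ball_r E i v \<subseteq> ball_r E j v"
  unfolding ball_r_def by (auto intro: le_trans)

text \<open>Strictness of \<open>j < r\<close> matters: a vertex at distance exactly
  \<open>r\<close> may have neighbors outside the view.\<close>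

lemma ball_view_neighbors:
  assumes "u \<in> ball_r E j v" "j < r"
  shows "E u w \<longleftrightarrow> u \<in> ball_r E r v \<and> w \<in> ball_r E r v \<and> E u w"
  using ball_r_neighbor[OF assms(1), of w] ball_r_mono[of j r E v] ball_r_mono[of "Suc j" r E v] assms
  by auto

text \<open>The color after \<open>i\<close> rounds depends on radius \<open>i\<close> around
  \<open>u\<close>. Unfolding one round trades a unit of \<open>i\<close> for a unit of the distance
  \<open>j\<close>, so \<open>i + j\<close> stays within \<open>r\<close>.\<close>

lemma iter_color_local:
  fixes E :: "nat \<Rightarrow> nat \<Rightarrow> bool" and r v :: nat
  defines "E' \<equiv> \<lambda>x y. x \<in> ball_r E r v \<and> y \<in> ball_r E r v \<and> E x y"
  assumes "u \<in> ball_r E j v" "i + j \<le> r"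
  shows "iter_color qs ds ts D E i u = iter_color qs ds ts D E' i u"
  using assms(2,3)
proof (induction i arbitrary: u j)
  case (Suc i)
  show ?case unfolding iter_color.simps
  proof (rule recolor_cong)
    show "E u w \<longleftrightarrow> E' u w" for w
      unfolding E'_def using Suc.prems by (intro ball_view_neighbors[of u E j]) auto
    show "iter_color qs ds ts D E i u = iter_color qs ds ts D E' i u"
      using Suc.prems by (intro Suc.IH[of u j]) auto
    show "iter_color qs ds ts D E i w = iter_color qs ds ts D E' i w" if "E u w" for w
      using Suc.prems ball_r_neighbor[OF Suc.prems(1) that] by (intro Suc.IH[of w "Suc j"]) auto
  qed
qed simp

text \<open>The radius is \<open>Suc T\<close> because choosing the free points is one more round
  after \<open>T\<close> recolorings.\<close>

lemma color_set_iter_local: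
  fixes E :: "nat \<Rightarrow> nat \<Rightarrow> bool" and T v :: nat
  defines "E' \<equiv> \<lambda>x y. x \<in> ball_r E (Suc T) v \<and> y \<in> ball_r E (Suc T) v \<and> E x y"
  shows "color_set E' (iter_color qs ds ts D E' T) q d t p v =
         color_set E (iter_color qs ds ts D E T) q d t p v"
proof (rule color_set_cong [symmetric])
  have v: "v \<in> ball_r E 0 v" by (simp add: ball_r_def)
  show "E v w \<longleftrightarrow> E' v w" for w
    unfolding E'_def using v by (intro ball_view_neighbors[of v E 0]) auto
  show "iter_color qs ds ts D E T v = iter_color qs ds ts D E' T v"
    unfolding E'_def using v by (intro iter_color_local[of v E 0]) auto
  show "iter_color qs ds ts D E T w = iter_color qs ds ts D E' T w" if "E v w" for w
    unfolding E'_def using ball_r_neighbor[of v E 0 v w] v that by (intro iter_color_local[of w E 1]) auto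
qed

section \<open>The number of colors along the iteration\<close>

lemma floor_log_less_iff: "b > 0 \<Longrightarrow> floor_log b < e \<longleftrightarrow> b < 2 ^ e"
proof
  assume "floor_log b < e"
  then have "2 * 2 ^ floor_log b \<le> (2::nat) ^ e" using power_increasing[of "Suc (floor_log b)" e "2::nat"] by simp
  then show "b < 2 ^ e" using floor_log_exp2_gt[of b] by linarith
next
  assume "b > 0" "b < 2 ^ e"
  then have "(2::nat) ^ floor_log b < 2 ^ e" using floor_log_exp2_le[of b] by linarith
  then show "floor_log b < e" by simp
qed

text \<open>At exponent \<open>4\<close> equality holds; the threshold \<open>5\<close> is the
  origin of the constant \<open>32 = 2 ^ 5\<close> below.\<close>

lemma linear_less_two_power:
  fixes e :: nat
  assumes "e \<ge> 5"
  shows "4 * e < 2 ^ e"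
  using assms by (induction e rule: dec_induct) auto

lemma four_floor_log_less:
  assumes "b > 32"
  shows "4 * floor_log b < b"
proof -
  have "\<not> floor_log b < 5" using assms by (subst floor_log_less_iff) auto
  then have "4 * floor_log b < 2 ^ floor_log b" by (intro linear_less_two_power) simp
  also have "\<dots> \<le> b" using assms by (intro floor_log_exp2_le) simp
  finally show ?thesis .
qed

text \<open>The factor \<open>4\<close> does not accumulate: the logarithm turns the factor
  \<open>32\<close> into a summand \<open>5\<close>, and \<open>4 * (5 + floor_log l)\<close> is
  again within the factor \<open>32\<close>.\<close>

lemma four_floor_log_le_mult:
  assumes "b \<le> 32 * max 1 l"
  shows "4 * floor_log b \<le> 32 * max 1 (floor_log l)"
proof (cases "b = 0")
  case False
  have "l < 2 ^ Suc (floor_log l)" using floor_log_exp2_gt[of l] by simp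
  moreover have "1 < (2::nat) ^ Suc (floor_log l)" by (rule one_less_power) auto
  ultimately have "max 1 l < 2 ^ Suc (floor_log l)" by simp
  with assms have "b < 32 * 2 ^ Suc (floor_log l)" by linarith
  then have "b < 2 ^ (6 + floor_log l)" by (simp add: power_add)
  then have "floor_log b < 6 + floor_log l" using False by (simp add: floor_log_less_iff)
  then show ?thesis by simp
qed simp

text \<open>Either the value is within a factor \<open>32\<close> of the iterated logarithm, and
  remains so, or it exceeds \<open>32\<close> and each step lowers it by at least one, which
  \<open>k ^ 2 - i\<close> records. The start value is at most the square of its larger
  factor.\<close>

lemma four_floor_log_iterate:
  "((\<lambda>b. 4 * floor_log b) ^^ Suc i) (k * Suc (floor_log n))
     \<le> max (max 32 (k ^ 2 - i)) (32 * max 1 ((floor_log ^^ Suc (Suc i)) n))"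
proof (induction i)
  case 0
  define L where "L = floor_log n"
  show ?case
  proof (cases "k \<le> Suc L")
    case True
    have "Suc L \<le> 2 ^ Suc (floor_log L)" using floor_log_exp2_gt[of L] by simp
    then have "k * Suc L \<le> 2 ^ Suc (floor_log L) * 2 ^ Suc (floor_log L)" using True by (intro mult_mono) auto
    also have "\<dots> = 2 ^ (2 * floor_log L + 2)" by (simp flip: power_add)
    finally have "floor_log (k * Suc L) \<le> floor_log (2 ^ (2 * floor_log L + 2))" by (rule floor_log_le_iff)
    then have "floor_log (k * Suc L) \<le> 2 * floor_log L + 2" by (simp only: floor_log_power)
    then have "4 * floor_log (k * Suc L) \<le> 32 * max 1 (floor_log L)" by simp
    then show ?thesis by (simp add: L_def)
  next
    case False
    then have "k * Suc L \<le> k ^ 2" unfolding power2_eq_square by (intro mult_left_mono) auto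
    moreover have "4 * floor_log b \<le> max 32 b" for b
      using four_floor_log_less[of b] floor_log_le_iff[of b "2 ^ 5"] floor_log_power[of 5]
      by (cases "b > 32") auto
    from this[of "k * Suc L"] have "4 * floor_log (k * Suc L) \<le> max 32 (k * Suc L)" .
    ultimately have "4 * floor_log (k * Suc L) \<le> max 32 (k ^ 2)" by simp
    then show ?thesis by (auto simp: L_def)
  qed
next
  case (Suc i)
  define b where "b = ((\<lambda>b. 4 * floor_log b) ^^ Suc i) (k * Suc (floor_log n))"
  define l where "l = (floor_log ^^ Suc (Suc i)) n"
  have IH: "b \<le> max (max 32 (k ^ 2 - i)) (32 * max 1 l)" using Suc.IH unfolding b_def l_def .
  have "4 * floor_log b \<le> max (max 32 (k ^ 2 - Suc i)) (32 * max 1 (floor_log l))"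
  proof (cases "b \<le> 32 * max 1 l")
    case True
    then show ?thesis using four_floor_log_le_mult[OF True] by linarith
  next
    case False
    then have "b > 32" by simp
    then show ?thesis using False IH four_floor_log_less[of b] by linarith
  qed
  then show ?case unfolding b_def l_def by simp
qed

text \<open>\<open>floor_log\<close> strictly lowers positive numbers, so the \<open>LEAST\<close>
  in \<open>log_star\<close> is attained and later iterates remain at most \<open>1\<close>.\<close>

lemma log_star_iterate:
  assumes "log_star n \<le> i"
  shows "(floor_log ^^ i) n \<le> 1"
proof -
  have less: "floor_log m < m" if "m > 0" for m
    using that by (simp add: floor_log_less_iff)
  have "(floor_log ^^ i) n \<le> max 1 (n - i)" for i
  proof (induction i)
    case (Suc i)
    let ?m = "(floor_log ^^ i) n"
    show ?case using Suc less[of ?m] by (cases "?m = 0") auto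
  qed simp
  from this[of n] have "\<exists>i. (floor_log ^^ i) n \<le> 1" by (intro exI[of _ n]) simp
  then have "(floor_log ^^ log_star n) n \<le> 1" unfolding log_star_def by (rule LeastI_ex)
  with assms show ?thesis
  proof (induction i rule: dec_induct)
    case (step i)
    then show ?case using less[of "(floor_log ^^ i) n"] by (cases "(floor_log ^^ i) n = 0") auto
  qed
qed

text \<open>With colors below \<open>2 ^ b\<close>, polynomials of degree \<open>b\<close> and a prime \<open>q\<close> of size about
  \<open>b * x * 2 ^ (T - i)\<close>, where \<open>x \<approx> \<Delta> / p\<close>, the new colors are below \<open>q\<^sup>2\<close>; \<open>s i\<close> bounds the
  logarithm of everything in \<open>q\<close> except the factor \<open>b\<close>.\<close>

fun stage_bits :: "(nat \<Rightarrow> nat) \<Rightarrow> nat \<Rightarrow> nat \<Rightarrow> nat \<Rightarrow> nat" where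
  "stage_bits s k n 0 = k * Suc (floor_log n)"
| "stage_bits s k n (Suc i) = 2 * (s i + floor_log (stage_bits s k n i))"

text \<open>Once \<open>floor_log (b i) \<le> s i\<close> holds it persists, since \<open>4 * s < 2 ^ s\<close> leaves room for the
  unit decrease of \<open>s\<close>; until then \<open>b\<close> is dominated by the iterates of \<open>4 * floor_log\<close>.\<close>

lemma stage_bits_final:
  assumes T: "T = k ^ 2 + log_star n + 2" and s: "s = (\<lambda>i. 12 + a + (T - i))"
  shows "stage_bits s k n T \<le> 4 * (13 + a)"
proof -
  let ?b = "stage_bits s k n" and ?h = "\<lambda>b. 4 * floor_log b"
  have "floor_log (?b i) \<le> s i \<or> ?b i \<le> (?h ^^ i) (k * Suc (floor_log n))" if "i \<le> T" for i
    using that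
  proof (induction i)
    case (Suc i)
    have si: "s i = Suc (s (Suc i))" "s i \<ge> 5" using Suc.prems unfolding s by auto
    show ?case
    proof (cases "floor_log (?b i) \<le> s i")
      case True
      then have "?b (Suc i) \<le> 4 * s i" by simp
      also have "\<dots> < 2 ^ s i" using si by (intro linear_less_two_power)
      finally have "floor_log (?b (Suc i)) < s i"
        using si by (subst floor_log_less_iff) auto
      then show ?thesis using si by simp
    next
      case False
      then have "?b i \<le> (?h ^^ i) (k * Suc (floor_log n))" using Suc by simp
      then have "floor_log (?b i) \<le> floor_log ((?h ^^ i) (k * Suc (floor_log n)))" by (rule floor_log_le_iff)
      then show ?thesis using False by simp
    qed
  qed simp
  from this[of "T - 1"] have dis: "floor_log (?b (T - 1)) \<le> s (T - 1) \<or>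
      ?b (T - 1) \<le> (?h ^^ Suc (k ^ 2 + log_star n)) (k * Suc (floor_log n))" unfolding T by simp
  \<comment> \<open>By now \<open>k ^ 2 - i\<close> is \<open>0\<close> and the iterated logarithm
    at most \<open>1\<close>, so only the constant \<open>32\<close> is left.\<close>
  have "(?h ^^ Suc (k ^ 2 + log_star n)) (k * Suc (floor_log n)) \<le> 32"
    using four_floor_log_iterate[of "k ^ 2 + log_star n" k n]
      log_star_iterate[of n "Suc (Suc (k ^ 2 + log_star n))"] by simp
  with dis have "floor_log (?b (T - 1)) \<le> s (T - 1) \<or> ?b (T - 1) \<le> 2 ^ 5" by auto
  moreover have "s (T - 1) = 13 + a" unfolding s T by simp
  ultimately have "floor_log (?b (T - 1)) \<le> 13 + a"
    using floor_log_le_iff[of "?b (T - 1)" "2 ^ 5"] floor_log_power[of 5] by linarith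
  moreover have "?b T = 2 * (s (T - 1) + floor_log (?b (T - 1)))"
    unfolding T by simp
  ultimately show ?thesis using \<open>s (T - 1) = 13 + a\<close> by simp
qed

text \<open>The choice depends on \<open>y\<close> alone, so all vertices use the same prime without
  communication.\<close>

definition next_prime :: "nat \<Rightarrow> nat" where
  "next_prime y = (SOME q. prime q \<and> y \<le> q \<and> q \<le> 2 ^ 10 * y)"

lemma next_prime:
  assumes "y \<ge> 1"
  shows "prime (next_prime y)" "y \<le> next_prime y" "next_prime y \<le> 2 ^ 10 * y"
  using someI_ex[OF prime_in_linear_range[OF assms]] unfolding next_prime_def by blast+

text \<open>Round \<open>i\<close> tolerates \<open>\<Delta> / t i\<close> conflicts, which is below
  \<open>p * 2 ^ i / 2 ^ Suc T\<close>. That is also the bound on the defect so far, so the bound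
  doubles in every round.\<close>

lemma iter_color_invariant:
  fixes T x a k n p \<Delta> :: nat
  defines "s \<equiv> \<lambda>i. 12 + a + (T - i)"
  defines "b \<equiv> stage_bits s k n"
  defines "t \<equiv> \<lambda>i. x * 2 ^ (Suc T - i)"
  defines "q \<equiv> \<lambda>i. next_prime (b i * t i)"
  assumes G: "simple_graph V E" "\<And>v. v \<in> V \<Longrightarrow> Defs.degree E v \<le> \<Delta>" "V \<subseteq> {..< n ^ k}"
    and k: "k \<ge> 1" and x: "\<Delta> < x * p" "x \<le> 2 ^ a"
  shows "i \<le> T \<Longrightarrow> \<forall>v\<in>V. iter_color q b t \<Delta> E i v < 2 ^ b i \<and>
    card {u. E v u \<and> iter_color q b t \<Delta> E i u = iter_color q b t \<Delta> E i v} * 2 ^ Suc T \<le> p * 2 ^ i"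
proof (induction i)
  case 0
  show ?case
  proof (intro ballI conjI)
    fix v assume v: "v \<in> V"
    have "n ^ k \<le> (2 ^ Suc (floor_log n)) ^ k" using floor_log_exp2_ge[of n] by (intro power_mono) auto
    also have "\<dots> = 2 ^ b 0" unfolding b_def by (simp only: power_mult [symmetric] stage_bits.simps mult.commute)
    finally show "iter_color q b t \<Delta> E 0 v < 2 ^ b 0" using v G(3) by fastforce
    have "{u. E v u \<and> iter_color q b t \<Delta> E 0 u = iter_color q b t \<Delta> E 0 v} = {}"
      using G(1) unfolding simple_graph_def by auto
    then show "card {u. E v u \<and> iter_color q b t \<Delta> E 0 u = iter_color q b t \<Delta> E 0 v} * 2 ^ Suc T \<le> p * 2 ^ 0"
      by (simp only: card.empty mult_0 zero_le)
  qed
next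
  case (Suc i)
  let ?f = "iter_color q b t \<Delta> E i" and ?g = "iter_color q b t \<Delta> E (Suc i)"
  have IH: "\<forall>v\<in>V. ?f v < 2 ^ b i \<and> card {u. E v u \<and> ?f u = ?f v} * 2 ^ Suc T \<le> p * 2 ^ i"
    using Suc by simp
  have x0: "x > 0" using x(1) by (cases x) auto
  have b0: "b i \<ge> 1" unfolding b_def s_def using k by (cases i) auto
  have bt: "b i * t i \<ge> 1" using b0 x0 unfolding t_def by simp
  have q: "prime (q i)" "b i * t i \<le> q i" "q i \<le> 2 ^ 10 * (b i * t i)"
    unfolding q_def by (rule next_prime[OF bt])+
  have q2: "q i \<ge> 2" using q(1) by (rule prime_ge_2_nat)
  have fin: "finite {u. E v u}" for v
    using G(1) unfolding simple_graph_def by (auto intro: finite_subset[of _ V])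
  have EV: "u \<in> V" if "E v u" for u v using G(1) that unfolding simple_graph_def by auto
  have small: "?f v < q i ^ Suc (b i)" if "v \<in> V" for v
  proof -
    have "?f v < 2 ^ b i" using IH that by blast
    also have "\<dots> \<le> 2 ^ Suc (b i)" by simp
    also have "\<dots> \<le> q i ^ Suc (b i)" using q2 by (intro power_mono) auto
    finally show ?thesis .
  qed
  have point: "\<exists>c. c < q i \<and> t i * conflicts E ?f (q i) (b i) v c \<le> \<Delta> \<and>
      ?g v = c * q i + digit_poly (q i) (b i) (?f v) c" if "v \<in> V" for v
  proof (rule recolor_obtain[of "q i" E v \<Delta> ?f "b i" "t i"])
    show "card {u. E v u} \<le> \<Delta>" using G(2)[OF that] by (simp add: Defs.degree_def)
    show "t i * b i \<le> q i" using q(2) by (simp add: mult.commute)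
  qed (use that small EV fin q(1) in auto)
  \<comment> \<open>The exponent of \<open>q i\<close> collects \<open>10\<close> from the prime
    gap, \<open>1\<close> from rounding \<open>floor_log (b i)\<close>, \<open>a\<close> from
    \<open>x\<close> and \<open>Suc T - i\<close> from \<open>t i\<close>: in total
    \<open>s i + floor_log (b i)\<close>. Squaring doubles it.\<close>
  have qb: "q i ^ 2 \<le> 2 ^ b (Suc i)"
  proof -
    have "b i \<le> 2 ^ Suc (floor_log (b i))" using floor_log_exp2_ge[of "b i"] by simp
    then have "b i * (x * 2 ^ (Suc T - i)) \<le> 2 ^ Suc (floor_log (b i)) * (2 ^ a * 2 ^ (Suc T - i))"
      using x(2) by (intro mult_mono) auto
    then have "q i \<le> 2 ^ 10 * (2 ^ Suc (floor_log (b i)) * (2 ^ a * 2 ^ (Suc T - i)))"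
      using q(3) unfolding t_def by (meson le_trans mult_le_mono2)
    also have "\<dots> = 2 ^ (10 + (Suc (floor_log (b i)) + (a + (Suc T - i))))" by (simp only: power_add)
    also have "10 + (Suc (floor_log (b i)) + (a + (Suc T - i))) = s i + floor_log (b i)"
      using Suc.prems unfolding s_def by simp
    finally have "q i ^ 2 \<le> (2 ^ (s i + floor_log (b i))) ^ 2" by (intro power_mono) auto
    also have "\<dots> = 2 ^ b (Suc i)" unfolding b_def by (simp only: power_mult [symmetric] stage_bits.simps mult.commute)
    finally show ?thesis .
  qed
  show ?case
  proof (intro ballI conjI)
    fix v assume v: "v \<in> V"
    obtain c where c: "c < q i" "t i * conflicts E ?f (q i) (b i) v c \<le> \<Delta>"
      "?g v = c * q i + digit_poly (q i) (b i) (?f v) c" using point[OF v] by blast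
    have "?g v < q i ^ 2" unfolding c(3) using c(1) q2 by (intro encode_less digit_poly_less) auto
    then show "?g v < 2 ^ b (Suc i)" using qb by linarith
    let ?C = "conflicts E ?f (q i) (b i) v c"
    have card: "card {u. E v u \<and> ?g u = ?g v} \<le> card {u. E v u \<and> ?f u = ?f v} + ?C"
      proof (rule card_same_color_le)
      show "q i > 0" using q2 by simp
      show "\<exists>c. ?g u = c * q i + digit_poly (q i) (b i) (?f u) c" if "E v u" for u
        using point[OF EV[OF that]] by blast
    qed (fact fin c(3))+
    \<comment> \<open>Cancelling \<open>x\<close> exchanges the degree bound \<open>\<Delta>\<close>
      for \<open>p\<close>.\<close>
    have "x * (2 ^ (Suc T - i) * ?C) = t i * ?C" by (simp add: t_def mult.assoc)
    then have "x * (2 ^ (Suc T - i) * ?C) < x * p" using c(2) x(1) by linarith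
    then have "2 ^ (Suc T - i) * ?C \<le> p" by simp
    then have "2 ^ i * (2 ^ (Suc T - i) * ?C) \<le> 2 ^ i * p" by simp
    moreover have "(2::nat) ^ i * 2 ^ (Suc T - i) = 2 ^ Suc T"
      using Suc.prems by (simp only: power_add [symmetric]) simp
    ultimately have "?C * 2 ^ Suc T \<le> p * 2 ^ i" by (metis mult.assoc mult.commute)
    moreover have "card {u. E v u \<and> ?f u = ?f v} * 2 ^ Suc T \<le> p * 2 ^ i" using IH v by blast
    moreover have "card {u. E v u \<and> ?g u = ?g v} * 2 ^ Suc T
        \<le> (card {u. E v u \<and> ?f u = ?f v} + ?C) * 2 ^ Suc T" using card by (rule mult_right_mono) simp
    ultimately show "card {u. E v u \<and> ?g u = ?g v} * 2 ^ Suc T \<le> p * 2 ^ Suc i"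
      by (simp add: add_mult_distrib)
  qed
qed

text \<open>The old defect and the conflicts at a free point are each at most \<open>p / 2\<close>.
  By Markov at most \<open>2 * x * d\<close> of the \<open>q \<ge> 4 * d * x\<close> points are not
  free.\<close>

lemma color_set_properties:
  fixes f :: "nat \<Rightarrow> nat" and q d p x \<Delta> :: nat
  assumes G: "simple_graph V E" "\<And>v. v \<in> V \<Longrightarrow> Defs.degree E v \<le> \<Delta>"
    and q: "prime q" "4 * d * x \<le> q" and d: "d \<ge> 1" and x: "\<Delta> < x * p"
    and f: "\<And>v. v \<in> V \<Longrightarrow> f v < q ^ Suc d"
      "\<And>v. v \<in> V \<Longrightarrow> 2 * card {u. E v u \<and> f u = f v} \<le> p"
  shows "v \<in> V \<Longrightarrow> color_set E f q d 2 p v \<subseteq> {1..q ^ 2}"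
    and "v \<in> V \<Longrightarrow> x \<le> card (color_set E f q d 2 p v)"
    and "\<forall>v\<in>V. \<phi> v \<in> color_set E f q d 2 p v \<Longrightarrow> defective_coloring V E p (q ^ 2) \<phi>"
proof -
  let ?S = "color_set E f q d 2 p" and ?F = "free_points E f q d 2 p"
  have fin: "finite {u. E v u}" for v
    using G(1) unfolding simple_graph_def by (auto intro: finite_subset[of _ V])
  have EV: "u \<in> V" if "E v u" for u v using G(1) that unfolding simple_graph_def by auto
  have q0: "q > 0" using q(1) by (rule prime_gt_0_nat)
  have p0: "p > 0" using x by (cases p) auto
  show sub: "?S v \<subseteq> {1..q ^ 2}" if "v \<in> V" for v
    unfolding color_set_def free_points_def
    using encode_less[of _ q] digit_poly_less[OF q0] by (auto simp: Suc_le_eq)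
  show "x \<le> card (?S v)" if v: "v \<in> V" for v
  proof -
    have "inj_on (\<lambda>a. Suc (a * q + digit_poly q d (f v) a)) (?F v)"
    proof (rule inj_on_inverseI)
      fix a show "(Suc (a * q + digit_poly q d (f v) a) - 1) div q = a"
        using digit_poly_less[OF q0, of d "f v" a] by simp
    qed
    then have card: "card (?S v) = card (?F v)" unfolding color_set_def by (rule card_image)
    have "(q - card (?F v)) * Suc p \<le> 2 * (card {u. E v u} * d)"
      using q(1) fin f(1) v EV by (intro few_non_free_points) auto
    also have "\<dots> \<le> 2 * (x * p * d)"
      using G(2)[OF v] x by (intro mult_left_mono mult_right_mono) (auto simp: Defs.degree_def)
    finally have "(q - card (?F v)) * Suc p \<le> (2 * x * d) * p" by (simp only: ac_simps)
    then have "(q - card (?F v)) * p \<le> (2 * x * d) * p" unfolding mult_Suc_right by linarith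
    then have "q - card (?F v) \<le> 2 * x * d" using p0 mult_le_cancel2 by blast
    then have "2 * x * d \<le> card (?F v)" using q(2) by (simp add: algebra_simps)
    moreover have "x * 1 \<le> 2 * x * d" using d by (intro mult_mono) auto
    ultimately show ?thesis using card by linarith
  qed
  show "defective_coloring V E p (q ^ 2) \<phi>" if \<phi>: "\<forall>v\<in>V. \<phi> v \<in> ?S v"
    unfolding defective_coloring_def
  proof (intro conjI ballI)
    show "\<phi> v \<in> {1..q ^ 2}" if "v \<in> V" for v using \<phi> sub that by blast
    have ex: "\<exists>a. \<phi> v = Suc (a * q + digit_poly q d (f v) a) \<and> 2 * conflicts E f q d v a \<le> p"
      if "v \<in> V" for v using \<phi> that unfolding color_set_def free_points_def by auto
    fix v assume v: "v \<in> V"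
    define g where "g u = \<phi> u - 1" for u
    have gg: "\<exists>a. g u = a * q + digit_poly q d (f u) a" if "u \<in> V" for u
      using ex[OF that] unfolding g_def by auto
    obtain a where a: "g v = a * q + digit_poly q d (f v) a" "2 * conflicts E f q d v a \<le> p"
      using ex[OF v] unfolding g_def by auto
    have "card {u. E v u \<and> \<phi> u = \<phi> v} \<le> card {u. E v u \<and> g u = g v}"
      using fin[of v] by (intro card_mono) (auto simp: g_def)
    also have "\<dots> \<le> card {u. E v u \<and> f u = f v} + conflicts E f q d v a"
    proof (rule card_same_color_le)
      show "\<exists>b. g u = b * q + digit_poly q d (f u) b" if "E v u" for u
        using gg[OF EV[OF that]] .
    qed (fact q0 fin a(1))+
    finally show "card {u. E v u \<and> \<phi> u = \<phi> v} \<le> p" using a(2) f(2)[OF v] by linarith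
  qed
qed

section \<open>The algorithm\<close>

text \<open>The summand \<open>k ^ 2\<close> pays for IDs as large as \<open>n ^ k\<close>.\<close>

definition defective_rounds :: "nat \<Rightarrow> nat \<Rightarrow> nat" where
  "defective_rounds k n = k ^ 2 + log_star n + 2"

text \<open>For \<open>p > 0\<close> this is the least \<open>x\<close> with
  \<open>\<Delta> < x * p\<close>.\<close>

definition quotient_bound :: "nat \<Rightarrow> nat \<Rightarrow> nat" where
  "quotient_bound \<Delta> p = Suc (\<Delta> div p)"

definition defective_iterate ::
  "nat \<Rightarrow> nat \<Rightarrow> nat \<Rightarrow> nat \<Rightarrow> (nat \<Rightarrow> nat \<Rightarrow> bool) \<Rightarrow> nat \<Rightarrow> nat" where
  "defective_iterate k n \<Delta> p E =
     (let T = defective_rounds k n; x = quotient_bound \<Delta> p; a = Suc (floor_log x);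
          b = stage_bits (\<lambda>i. 12 + a + (T - i)) k n; t = (\<lambda>i. x * 2 ^ (Suc T - i))
      in iter_color (\<lambda>i. next_prime (b i * t i)) b t \<Delta> E T)"

text \<open>\<open>2 ^ 16 = 4 * 2 ^ 14\<close> is the size of \<open>q / x\<close> that degree
  \<open>2 ^ 14\<close> demands. The iteration ends with colors below
  \<open>(2 ^ 14 * x) ^ 4 \<le> q ^ 4\<close>, which fit into the available digits.\<close>

definition defective_domain ::
  "nat \<Rightarrow> nat \<Rightarrow> nat \<Rightarrow> nat \<Rightarrow> (nat \<Rightarrow> nat \<Rightarrow> bool) \<Rightarrow> nat \<Rightarrow> nat set" where
  "defective_domain k n \<Delta> p E =
     color_set E (defective_iterate k n \<Delta> p E) (next_prime (2 ^ 16 * quotient_bound \<Delta> p)) (2 ^ 14) 2 p"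

lemma defective_domain_local:
  "run_local (\<lambda>n \<Delta> p B. defective_domain k n \<Delta> p) (Suc (defective_rounds k n)) n \<Delta> p E =
   defective_domain k n \<Delta> p E"
  unfolding run_local_def defective_domain_def defective_iterate_def Let_def
  by (rule ext) (rule color_set_iter_local)

lemma defective_domain_correct:
  fixes n k p \<Delta> :: nat and E :: "nat \<Rightarrow> nat \<Rightarrow> bool"
  defines "m \<equiv> next_prime (2 ^ 16 * quotient_bound \<Delta> p) ^ 2"
  assumes k: "k \<ge> 1" and G: "simple_graph V E" "V \<subseteq> {..< n ^ k}" "max_degree_is V E \<Delta>"
    and p: "1 \<le> p" "p \<le> \<Delta>"
  shows "real m \<le> 2 ^ 54 * (real \<Delta> / real p) ^ 2"
    and "v \<in> V \<Longrightarrow> defective_domain k n \<Delta> p E v \<subseteq> {1..m}"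
    and "v \<in> V \<Longrightarrow> real \<Delta> / real p \<le> real (card (defective_domain k n \<Delta> p E v))"
    and "\<forall>v\<in>V. \<phi> v \<in> defective_domain k n \<Delta> p E v \<Longrightarrow> defective_coloring V E p m \<phi>"
proof -
  define x where "x = quotient_bound \<Delta> p"
  define q where "q = next_prime (2 ^ 16 * x)"
  define a where "a = Suc (floor_log x)"
  define T where "T = defective_rounds k n"
  have m: "m = q ^ 2" unfolding m_def q_def x_def ..
  have x1: "x \<ge> 1" unfolding x_def quotient_bound_def by simp
  have xp: "\<Delta> < x * p" unfolding x_def quotient_bound_def
    using p dividend_less_div_times[of p \<Delta>] by (simp add: add.commute)
  have xa: "x \<le> 2 ^ a" "2 ^ a \<le> 2 * x"
    unfolding a_def using floor_log_exp2_ge[of x] floor_log_exp2_le[of x] x1 by auto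
  have q: "prime q" "2 ^ 16 * x \<le> q" "q \<le> 2 ^ 10 * (2 ^ 16 * x)"
    unfolding q_def using next_prime[of "2 ^ 16 * x"] x1 by auto
  have deg: "\<And>v. v \<in> V \<Longrightarrow> Defs.degree E v \<le> \<Delta>" using G(3) unfolding max_degree_is_def by blast
  let ?f = "defective_iterate k n \<Delta> p E"
  let ?b = "stage_bits (\<lambda>i. 12 + a + (T - i)) k n"
  have inv: "\<forall>v\<in>V. ?f v < 2 ^ ?b T \<and> card {u. E v u \<and> ?f u = ?f v} * 2 ^ Suc T \<le> p * 2 ^ T"
    unfolding defective_iterate_def Let_def x_def [symmetric] a_def [symmetric] T_def [symmetric]
    by (rule iter_color_invariant[OF G(1) deg G(2) k xp xa(1)]) auto
  have f1: "?f v < q ^ Suc (2 ^ 14)" if "v \<in> V" for v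
  proof -
    have "?f v < 2 ^ ?b T" using inv that by blast
    also have "?b T \<le> 4 * (13 + a)" by (rule stage_bits_final) (simp_all add: T_def defective_rounds_def)
    then have "(2::nat) ^ ?b T \<le> 2 ^ (4 * (13 + a))" by (rule power_increasing) simp
    also have "\<dots> = (2 ^ 13 * 2 ^ a) ^ 4" by (simp only: power_add [symmetric] power_mult [symmetric] mult.commute[of 4])
    also have "\<dots> \<le> q ^ 4" using xa(2) q(2) by (intro power_mono) auto
    also have "\<dots> \<le> q ^ Suc (2 ^ 14)" using prime_gt_0_nat[OF q(1)] by (intro power_increasing) auto
    finally show ?thesis .
  qed
  \<comment> \<open>The invariant at \<open>i = T\<close> leaves one factor \<open>2\<close> of
    \<open>2 ^ Suc T\<close>, hence defect at most \<open>p / 2\<close>.\<close>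
  have f2: "2 * card {u. E v u \<and> ?f u = ?f v} \<le> p" if "v \<in> V" for v
    using inv that by (simp add: mult.commute)
  have dom: "defective_domain k n \<Delta> p E = color_set E ?f q (2 ^ 14) 2 p"
    unfolding defective_domain_def q_def x_def ..
  have q4: "4 * 2 ^ 14 * x \<le> q" using q(2) by simp
  note P = color_set_properties[OF G(1) deg q(1) q4 _ xp f1 f2]
  show "defective_domain k n \<Delta> p E v \<subseteq> {1..m}" if "v \<in> V"
    unfolding m dom using that by (intro P(1)) auto
  show "defective_coloring V E p m \<phi>" if "\<forall>v\<in>V. \<phi> v \<in> defective_domain k n \<Delta> p E v"
    unfolding m using that[unfolded dom] by (intro P(3)) auto
  have r: "real \<Delta> / real p \<le> real x"
  proof -
    have "real \<Delta> \<le> real (x * p)" using xp by linarith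
    then show ?thesis using p by (simp add: divide_le_eq)
  qed
  show "real \<Delta> / real p \<le> real (card (defective_domain k n \<Delta> p E v))" if "v \<in> V"
  proof -
    have "x \<le> card (defective_domain k n \<Delta> p E v)"
      unfolding dom using that by (intro P(2)) auto
    then show ?thesis using r by linarith
  qed
  \<comment> \<open>The rounding up by one is absorbed since \<open>p \<le> \<Delta>\<close>. With
    \<open>q \<le> 2 ^ 26 * x\<close> this gives \<open>2 ^ 27\<close>, and squared the constant
    \<open>2 ^ 54\<close>.\<close>
  have x2: "real x \<le> 2 * (real \<Delta> / real p)"
  proof -
    have "real (\<Delta> div p) \<le> real \<Delta> / real p" by (rule of_nat_div_le_of_nat)
    moreover have "1 \<le> real \<Delta> / real p" using p by simp
    ultimately show ?thesis unfolding x_def quotient_bound_def by simp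
  qed
  have "real q \<le> real (2 ^ 10 * (2 ^ 16 * x))" using q(3) by (rule of_nat_mono)
  also have "\<dots> \<le> 2 ^ 27 * (real \<Delta> / real p)" using x2 by simp
  finally have "real q ^ 2 \<le> (2 ^ 27 * (real \<Delta> / real p)) ^ 2" by (intro power_mono) auto
  also have "\<dots> = 2 ^ 54 * (real \<Delta> / real p) ^ 2" unfolding power_mult_distrib by simp
  finally show "real m \<le> 2 ^ 54 * (real \<Delta> / real p) ^ 2" unfolding m by simp
qed

theorem theorem5:
  shows "\<exists>C c :: real. C > 0 \<and> c > 0 \<and>
    (\<forall>k::nat. k \<ge> 1 \<longrightarrow>
      (\<exists>(A :: nat \<Rightarrow> nat \<Rightarrow> nat \<Rightarrow> nat set \<Rightarrow> (nat \<Rightarrow> nat \<Rightarrow> bool) \<Rightarrow> nat \<Rightarrow> nat set)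
          (rounds :: nat \<Rightarrow> nat \<Rightarrow> nat \<Rightarrow> nat) (R :: nat).
        (\<forall>n \<Delta> p. rounds n \<Delta> p \<le> R * (log_star n + 1)) \<and>
        (\<forall>(V :: nat set) (E :: nat \<Rightarrow> nat \<Rightarrow> bool) n \<Delta> p.
           simple_graph V E \<and> card V = n \<and> V \<subseteq> {..< n ^ k} \<and>
           max_degree_is V E \<Delta> \<and> 1 \<le> p \<and> p \<le> \<Delta> \<longrightarrow>
           (let S = run_local A (rounds n \<Delta> p) n \<Delta> p E in
            \<exists>m::nat. real m \<le> C * (real \<Delta> / real p)^2 \<and>
              (\<forall>v\<in>V. S v \<subseteq> {1..m} \<and> c * real \<Delta> / real p \<le> real (card (S v))) \<and>
              (\<forall>\<phi>. (\<forall>v\<in>V. \<phi> v \<in> S v) \<longrightarrow> defective_coloring V E p m \<phi>)))))"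
proof (rule exI[of _ "2 ^ 54"], rule exI[of _ 1], intro conjI allI impI)
  fix k :: nat assume k: "k \<ge> 1"
  let ?A = "\<lambda>n \<Delta> p (B :: nat set). defective_domain k n \<Delta> p"
  let ?rounds = "\<lambda>n (\<Delta> :: nat) (p :: nat). Suc (defective_rounds k n)"
  \<comment> \<open>The factor \<open>R\<close> depends on the ID exponent \<open>k\<close>, while
    the constants \<open>2 ^ 54\<close> and \<open>1\<close> do not.\<close>
  have "?rounds n \<Delta> p \<le> (k ^ 2 + 3) * (log_star n + 1)" for n \<Delta> p
    unfolding defective_rounds_def by simp
  moreover have "let S = run_local ?A (?rounds n \<Delta> p) n \<Delta> p E in
      \<exists>m::nat. real m \<le> 2 ^ 54 * (real \<Delta> / real p)^2 \<and>
        (\<forall>v\<in>V. S v \<subseteq> {1..m} \<and> 1 * real \<Delta> / real p \<le> real (card (S v))) \<and>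
        (\<forall>\<phi>. (\<forall>v\<in>V. \<phi> v \<in> S v) \<longrightarrow> defective_coloring V E p m \<phi>)"
    if "simple_graph V E \<and> card V = n \<and> V \<subseteq> {..< n ^ k} \<and>
      max_degree_is V E \<Delta> \<and> 1 \<le> p \<and> p \<le> \<Delta>" for V E n \<Delta> p
  proof -
    have "simple_graph V E" "V \<subseteq> {..< n ^ k}" "max_degree_is V E \<Delta>" "1 \<le> p" "p \<le> \<Delta>"
      using that by auto
    note P = defective_domain_correct[OF k this]
    show ?thesis unfolding defective_domain_local Let_def mult_1
      using P by (intro exI[of _ "next_prime (2 ^ 16 * quotient_bound \<Delta> p) ^ 2"]) blast
  qed
  ultimately show "\<exists>(A :: nat \<Rightarrow> nat \<Rightarrow> nat \<Rightarrow> nat set \<Rightarrow> (nat \<Rightarrow> nat \<Rightarrow> bool) \<Rightarrow> nat \<Rightarrow> nat set)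
          (rounds :: nat \<Rightarrow> nat \<Rightarrow> nat \<Rightarrow> nat) (R :: nat).
        (\<forall>n \<Delta> p. rounds n \<Delta> p \<le> R * (log_star n + 1)) \<and>
        (\<forall>(V :: nat set) (E :: nat \<Rightarrow> nat \<Rightarrow> bool) n \<Delta> p.
           simple_graph V E \<and> card V = n \<and> V \<subseteq> {..< n ^ k} \<and>
           max_degree_is V E \<Delta> \<and> 1 \<le> p \<and> p \<le> \<Delta> \<longrightarrow>
           (let S = run_local A (rounds n \<Delta> p) n \<Delta> p E in
            \<exists>m::nat. real m \<le> 2 ^ 54 * (real \<Delta> / real p)^2 \<and>
              (\<forall>v\<in>V. S v \<subseteq> {1..m} \<and> 1 * real \<Delta> / real p \<le> real (card (S v))) \<and>
              (\<forall>\<phi>. (\<forall>v\<in>V. \<phi> v \<in> S v) \<longrightarrow> defective_coloring V E p m \<phi>)))"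
    by (intro exI[of _ ?A] exI[of _ ?rounds] exI[of _ "k ^ 2 + 3"]) blast
qed simp_all

end
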